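(* Let $n\ge 1$ and $1\le k\le n$ be integers, and let $P_{n,k}$ be the poset on $\{1,2,\dots,n\}$ in which $k<_P a$ for every $a\neq k$ and no other pairs of distinct elements are comparable. Then the descent polynomial $F_{\mathcal{L}(P_{n,k})}(x)$ has only real zeroes, and these zeroes are distinct.
   Context: $S_n$ is the set of permutations of $\{1,\dots,n\}$, identified with sequences $\pi(1),\dots,\pi(n)$. A descent of $\pi$ is an index $i$ with $1\le i\le n-1$ and $\pi(i)>\pi(i+1)$; $\mathrm{Des}(\pi)$ is the number of descents. For $A\subseteq S_n$ the descent polynomial is $F_A(x)=\sum_{\pi\in A} x^{\mathrm{Des}(\pi)}$. For a poset $P$ on $\{1,\dots,n\}$, a linear extension is a $\pi\in S_n$ such that whenever $i<_P j$, $i$ appears before $j$ in the list $\pi(1),\dots,\pi(n)$; $\mathcal{L}(P)$ is the set of linear extensions. (Thus $\mathcal{L}(P_{n,k})$ is the set of $\pi\in S_n$ with $\pi(1)=k$.) *)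

theory Defs
  imports Complex_Main "HOL-Combinatorics.Permutations" "HOL-Computational_Algebra.Polynomial"
begin

definition Des :: "nat \<Rightarrow> (nat \<Rightarrow> nat) \<Rightarrow> nat" where
  "Des n \<pi> = card {i. 1 \<le> i \<and> i \<le> n - 1 \<and> \<pi> i > \<pi> (i + 1)}"

definition descent_poly :: "nat \<Rightarrow> (nat \<Rightarrow> nat) set \<Rightarrow> 'a::comm_semiring_1 poly" where
  "descent_poly n A = (\<Sum>\<pi>\<in>A. monom 1 (Des n \<pi>))"

text \<open>A poset on \<open>{1..n}\<close> is given by its reflexive order relation \<open>r\<close>; the position of
  the value \<open>i\<close> in the list \<open>\<pi> 1, \<dots>, \<pi> n\<close> is \<open>inv \<pi> i\<close>.\<close>

definition linear_extensions :: "nat \<Rightarrow> nat rel \<Rightarrow> (nat \<Rightarrow> nat) set" where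
  "linear_extensions n r =
     {\<pi>. \<pi> permutes {1..n} \<and> (\<forall>i j. (i, j) \<in> r \<and> i \<noteq> j \<longrightarrow> inv \<pi> i < inv \<pi> j)}"

definition poset_P :: "nat \<Rightarrow> nat \<Rightarrow> nat rel" where
  "poset_P n k = Id_on {1..n} \<union> {(k, a) | a. a \<in> {1..n} \<and> a \<noteq> k}"

lemma partial_order_on_poset_P:
  assumes "1 \<le> k" "k \<le> n"
  shows "partial_order_on {1..n} (poset_P n k)"
  using assms
  by (auto simp: poset_P_def partial_order_on_def preorder_on_def refl_on_def trans_def antisym_def)

lemma linear_extensions_poset_P:
  assumes "1 \<le> k" "k \<le> n"
  shows "linear_extensions n (poset_P n k) = {\<pi>. \<pi> permutes {1..n} \<and> \<pi> 1 = k}"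
proof (intro set_eqI iffI)
  fix \<pi> assume "\<pi> \<in> linear_extensions n (poset_P n k)"
  then have perm: "\<pi> permutes {1..n}"
    and ext: "\<And>i j. (i, j) \<in> poset_P n k \<Longrightarrow> i \<noteq> j \<Longrightarrow> inv \<pi> i < inv \<pi> j"
    by (auto simp: linear_extensions_def)
  have \<pi>1: "\<pi> 1 \<in> {1..n}"
    using permutes_in_image[OF perm, of 1] assms by auto
  have "inv \<pi> k \<in> {1..n}"
    using permutes_in_image[OF permutes_inv[OF perm], of k] assms by auto
  then have "\<not> inv \<pi> k < inv \<pi> (\<pi> 1)"
    using permutes_inverses(2)[OF perm] by auto
  then have "\<pi> 1 = k"
    using ext[of k "\<pi> 1"] \<pi>1 by (auto simp: poset_P_def)
  with perm show "\<pi> \<in> {\<pi>. \<pi> permutes {1..n} \<and> \<pi> 1 = k}" by simp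
next
  fix \<pi> assume "\<pi> \<in> {\<pi>. \<pi> permutes {1..n} \<and> \<pi> 1 = k}"
  then have perm: "\<pi> permutes {1..n}" and \<pi>1: "\<pi> 1 = k" by auto
  have inv_k: "inv \<pi> k = 1"
    using permutes_inverses(2)[OF perm, of 1] \<pi>1 by simp
  have "1 < inv \<pi> j" if "j \<in> {1..n}" "j \<noteq> k" for j
  proof -
    have "inv \<pi> j \<in> {1..n}"
      using permutes_in_image[OF permutes_inv[OF perm], of j] that by auto
    moreover have "inv \<pi> j \<noteq> 1"
      using permutes_inverses(1)[OF perm, of j] \<pi>1 that by auto
    ultimately show ?thesis by auto
  qed
  then show "\<pi> \<in> linear_extensions n (poset_P n k)"
    using perm inv_k by (auto simp: linear_extensions_def poset_P_def)
qed

end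

theory Submission
  imports Defs
begin

text \<open>
  Let \<open>F(n,k)\<close> be the descent polynomial of the permutations of \<open>{1..n}\<close> with first entry \<open>k\<close>.
  Deleting the first entry expresses \<open>F(n+1,k)\<close> as a combination of all the \<open>F(n,j)\<close>. By induction
  this yields the one-term recurrences \<open>F(n+1,k+1) = x L\<^sub>n F(n,k)\<close> and \<open>F(n+1,1) = L\<^sub>n F(n,n)\<close>, where
  \<open>L\<^sub>n F = (1 - x) F' + n F = (1 - x)\<^bsup>n+1\<^esup> (F / (1 - x)\<^sup>n)'\<close>. If \<open>F\<close> has degree \<open>d < n\<close> and \<open>d\<close> distinct
  nonpositive zeros, then \<open>F / (1 - x)\<^sup>n\<close> vanishes at these zeros and at \<open>-\<infinity>\<close>, so Rolle's theorem
  gives \<open>d\<close> distinct negative zeros of \<open>L\<^sub>n F\<close>.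
\<close>

section \<open>Prepending a first entry to a permutation\<close>

definition first_entry_perms :: "nat \<Rightarrow> nat \<Rightarrow> (nat \<Rightarrow> nat) set" where
  "first_entry_perms n k = {\<pi>. \<pi> permutes {1..n} \<and> \<pi> 1 = k}"

text \<open>Inverse of deleting the first entry and standardizing: values from \<open>k\<close> on
  move up by one to free the value \<open>k\<close>. Arguments outside \<open>{1..n + 1}\<close>
  stay fixed, as \<open>permutes\<close> demands.\<close>

definition prepend_entry :: "nat \<Rightarrow> nat \<Rightarrow> (nat \<Rightarrow> nat) \<Rightarrow> nat \<Rightarrow> nat" where
  "prepend_entry n k \<sigma> i =
     (if i = 1 then k
      else if i \<in> {2..n + 1} then if \<sigma> (i - 1) < k then \<sigma> (i - 1) else \<sigma> (i - 1) + 1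
      else i)"

lemma prepend_entry_permutes:
  assumes \<sigma>: "\<sigma> permutes {1..n}" and k: "1 \<le> k" "k \<le> n + 1"
  shows "prepend_entry n k \<sigma> permutes {1..n + 1}"
proof (rule inj_imp_permutes)
  have rng: "1 \<le> \<sigma> i \<and> \<sigma> i \<le> n" if "1 \<le> i" "i \<le> n" for i
    using permutes_in_image[OF \<sigma>, of i] that by simp
  have inj: "\<sigma> a = \<sigma> b \<longleftrightarrow> a = b" for a b
    using permutes_inj[OF \<sigma>] by (auto dest: injD)
  show "inj_on (prepend_entry n k \<sigma>) {1..n + 1}"
  proof (rule linorder_inj_onI)
    fix a b assume ab: "a < b" "a \<in> {1..n + 1}" "b \<in> {1..n + 1}"
    show "prepend_entry n k \<sigma> a \<noteq> prepend_entry n k \<sigma> b"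
    proof (cases "a = 1")
      case True
      then show ?thesis using ab by (auto simp: prepend_entry_def)
    next
      case False
      then have "\<sigma> (a - 1) \<noteq> \<sigma> (b - 1)" using ab inj by auto
      then show ?thesis using ab False by (auto simp: prepend_entry_def)
    qed
  qed auto
  show "prepend_entry n k \<sigma> x \<in> {1..n + 1}" if "x \<in> {1..n + 1}" for x
    using that rng[of "x - 1"] k by (auto simp: prepend_entry_def)
qed (auto simp: prepend_entry_def)

lemma bij_betw_prepend_entry:
  assumes k: "1 \<le> k" "k \<le> n + 1"
  shows "bij_betw (prepend_entry n k) {\<sigma>. \<sigma> permutes {1..n}} (first_entry_perms (n + 1) k)"
proof (rule bij_betw_imageI)
  show "inj_on (prepend_entry n k) {\<sigma>. \<sigma> permutes {1..n}}"
  proof (rule inj_onI)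
    fix \<sigma> \<tau> assume st: "\<sigma> \<in> {\<sigma>. \<sigma> permutes {1..n}}" "\<tau> \<in> {\<sigma>. \<sigma> permutes {1..n}}"
      and eq: "prepend_entry n k \<sigma> = prepend_entry n k \<tau>"
    show "\<sigma> = \<tau>"
    proof
      fix i show "\<sigma> i = \<tau> i"
      proof (cases "i \<in> {1..n}")
        case True
        then show ?thesis using fun_cong[OF eq, of "i + 1"]
          by (auto simp: prepend_entry_def split: if_splits)
      next
        case False
        then show ?thesis using st by (simp add: permutes_not_in)
      qed
    qed
  qed
  have "prepend_entry n k \<sigma> \<in> first_entry_perms (n + 1) k" if "\<sigma> permutes {1..n}" for \<sigma>
    using prepend_entry_permutes[OF that k] by (simp add: first_entry_perms_def prepend_entry_def)
  moreover have "\<pi> \<in> prepend_entry n k ` {\<sigma>. \<sigma> permutes {1..n}}"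
    if "\<pi> \<in> first_entry_perms (n + 1) k" for \<pi>
  proof -
    have \<pi>: "\<pi> permutes {1..n + 1}" and \<pi>1: "\<pi> 1 = k"
      using that by (auto simp: first_entry_perms_def)
    have inj: "\<pi> a = \<pi> b \<longleftrightarrow> a = b" for a b
      using permutes_inj[OF \<pi>] by (auto dest: injD)
    have rng: "1 \<le> \<pi> i \<and> \<pi> i \<le> n + 1" if "1 \<le> i" "i \<le> n + 1" for i
      using permutes_in_image[OF \<pi>, of i] that by simp
    have nk: "\<pi> (i + 1) \<noteq> k" if "1 \<le> i" for i
      using inj[of "i + 1" 1] \<pi>1 that by simp
    \<comment> \<open>The preimage drops the first entry and closes the gap at \<open>k\<close>. By
      \<open>nk\<close> a value that is not below \<open>k\<close> exceeds it, so the truncated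
      subtraction is exact.\<close>
    define \<sigma> where "\<sigma> i = (if i \<in> {1..n} then if \<pi> (i + 1) < k then \<pi> (i + 1) else \<pi> (i + 1) - 1
      else i)" for i
    have "\<sigma> permutes {1..n}"
    proof (rule inj_imp_permutes)
      show "inj_on \<sigma> {1..n}"
      proof (rule linorder_inj_onI)
        fix a b assume ab: "a < b" "a \<in> {1..n}" "b \<in> {1..n}"
        then show "\<sigma> a \<noteq> \<sigma> b"
          using inj[of "a + 1" "b + 1"] nk[of a] nk[of b] by (auto simp: \<sigma>_def)
      qed auto
      show "\<sigma> x \<in> {1..n}" if "x \<in> {1..n}" for x
        using that rng[of "x + 1"] nk[of x] k by (auto simp: \<sigma>_def)
    qed (auto simp: \<sigma>_def)
    moreover have "prepend_entry n k \<sigma> i = \<pi> i" for i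
    proof (cases "i \<in> {2..n + 1}")
      case True
      then show ?thesis using nk[of "i - 1"] by (auto simp: prepend_entry_def \<sigma>_def)
    next
      case False
      then show ?thesis using \<pi>1 permutes_not_in[OF \<pi>, of i]
        by (auto simp: prepend_entry_def)
    qed
    ultimately show ?thesis by (intro image_eqI[of _ _ \<sigma>]) auto
  qed
  ultimately show "prepend_entry n k ` {\<sigma>. \<sigma> permutes {1..n}} = first_entry_perms (n + 1) k"
    by auto
qed

text \<open>The relabelling is strictly increasing, so old descents persist one place to the right.
  The new position 1 is a descent iff \<open>\<sigma> 1 < k\<close>, since otherwise the second
  entry is \<open>\<sigma> 1 + 1 > k\<close>.\<close>

lemma Des_prepend_entry:
  assumes n: "1 \<le> n"
  shows "Des (n + 1) (prepend_entry n k \<sigma>) = (if \<sigma> 1 < k then 1 else 0) + Des n \<sigma>"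
proof -
  let ?D = "{i. 1 \<le> i \<and> i \<le> n - 1 \<and> \<sigma> i > \<sigma> (i + 1)}"
  have fin: "finite ?D" by (rule finite_subset[of _ "{..n}"]) auto
  have "{i. 1 \<le> i \<and> i \<le> n + 1 - 1 \<and> prepend_entry n k \<sigma> i > prepend_entry n k \<sigma> (i + 1)}
      = (if \<sigma> 1 < k then {1} else {}) \<union> Suc ` ?D" (is "?L = ?R")
  proof (intro set_eqI)
    fix i
    consider "i = 0" | "i = 1" | j where "i = Suc j" "1 \<le> j"
      by (cases i) (auto, metis One_nat_def Suc_leI neq0_conv)
    then show "i \<in> ?L \<longleftrightarrow> i \<in> ?R"
    proof cases
      case 2
      then show ?thesis using n by (auto simp: prepend_entry_def)
    next
      case 3
      then show ?thesis using n by (auto simp: prepend_entry_def image_iff)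
    qed auto
  qed
  moreover have "card ?R = (if \<sigma> 1 < k then 1 else 0) + card (Suc ` ?D)"
    using fin by (auto simp: card_insert_if)
  ultimately show ?thesis by (simp add: Des_def card_image)
qed

abbreviation first_entry_poly :: "nat \<Rightarrow> nat \<Rightarrow> 'a::comm_semiring_1 poly" where
  "first_entry_poly n k \<equiv> descent_poly n (first_entry_perms n k)"

text \<open>Group the shortened permutations by their first entry \<open>j\<close>; the factor x
  records the new descent when \<open>j < k\<close>.\<close>

lemma first_entry_poly_Suc:
  assumes n: "1 \<le> n" and k: "1 \<le> k" "k \<le> n + 1"
  shows "first_entry_poly (n + 1) k =
    (\<Sum>j\<in>{1..n}. (if j < k then monom 1 1 else 1) * first_entry_poly n j)"
proof -
  let ?S = "{\<sigma>. \<sigma> permutes {1..n}}"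
  let ?x = "\<lambda>j. if j < k then monom 1 1 else (1 :: 'a poly)"
  have fin: "finite ?S" by (rule finite_permutations) simp
  have "first_entry_poly (n + 1) k = (\<Sum>\<sigma>\<in>?S. monom (1::'a) (Des (n + 1) (prepend_entry n k \<sigma>)))"
    unfolding descent_poly_def by (rule sum.reindex_bij_betw[OF bij_betw_prepend_entry[OF k], symmetric])
  also have "\<dots> = (\<Sum>\<sigma>\<in>?S. ?x (\<sigma> 1) * monom 1 (Des n \<sigma>))"
    unfolding Des_prepend_entry[OF n] by (rule sum.cong) (auto simp: mult_monom)
  also have "\<dots> = (\<Sum>j\<in>{1..n}. \<Sum>\<sigma>\<in>{\<sigma>\<in>?S. \<sigma> 1 = j}. ?x (\<sigma> 1) * monom 1 (Des n \<sigma>))"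
  proof (rule sum.group[symmetric, OF fin])
    show "(\<lambda>\<sigma>. \<sigma> 1) ` ?S \<subseteq> {1..n}"
      using permutes_in_image[of _ "{1..n}" 1] n by auto
  qed simp
  also have "\<dots> = (\<Sum>j\<in>{1..n}. ?x j * first_entry_poly n j)"
    by (intro sum.cong refl) (simp add: descent_poly_def first_entry_perms_def sum_distrib_left)
  finally show ?thesis .
qed

lemma first_entry_poly_1: "first_entry_poly 1 1 = 1"
proof -
  have "first_entry_perms 1 1 = {id}"
    by (auto simp: first_entry_perms_def)
  moreover have "Des 1 id = 0" by (simp add: Des_def)
  ultimately show ?thesis by (simp add: descent_poly_def)
qed

section \<open>The operator \<open>L\<^sub>n\<close> and the one-term recurrences\<close>

definition euler_op :: "nat \<Rightarrow> 'a::idom poly \<Rightarrow> 'a poly" where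
  "euler_op n F = [:1, -1:] * pderiv F + of_nat n * F"

lemma euler_op_sum: "euler_op n (\<Sum>j\<in>A. f j) = (\<Sum>j\<in>A. euler_op n (f j))"
  by (induction A rule: infinite_finite_induct)
     (simp_all add: euler_op_def pderiv_add distrib_left add_ac del: mult_pCons_left)

lemma euler_op_Suc: "euler_op (n + 1) F = euler_op n F + F"
  by (simp add: euler_op_def algebra_simps)

text \<open>The product rule contributes \<open>(1 - x) F\<close>, and raising n contributes
  \<open>x F\<close>; together they leave \<open>F\<close>. This is the same remainder as in
  \<open>euler_op_Suc\<close>, so terms with and without a factor x can be treated
  uniformly.\<close>

lemma euler_op_Suc_mult_X: "euler_op (n + 1) (monom 1 1 * F) = monom 1 1 * euler_op n F + F"
proof -
  have X: "monom 1 1 = [:0, 1::'a:]" by (simp add: monom_altdef)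
  have one: "[:1, -1:] = 1 - [:0, 1::'a:]" by (simp add: one_pCons)
  have dX: "pderiv [:0, 1::'a:] = 1" by (simp add: pderiv_pCons one_pCons)
  show ?thesis unfolding X euler_op_def one pderiv_mult dX
    by (simp add: algebra_simps del: mult_pCons_left mult_pCons_right)
qed

lemma sum_shift_Suc: "(\<Sum>j\<in>{1..n+1}. f j) = f 1 + (\<Sum>j\<in>{1..n}. f (j + 1))"
  for f :: "nat \<Rightarrow> 'a::comm_monoid_add" and n :: nat
proof -
  have "(\<Sum>j\<in>{1..n+1}. f j) = f 1 + (\<Sum>j\<in>{1+1..n+1}. f j)"
    using sum.atLeast_Suc_atMost[of 1 "n+1" f] by simp
  then show ?thesis by (simp only: sum.shift_bounds_cl_nat_ivl)
qed

text \<open>Expand \<open>F(n+1,k)\<close> over the \<open>F(n,j)\<close> and apply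
  \<open>x L\<^sub>n\<^sub>+\<^sub>1\<close> termwise. By induction each term yields its weight
  times \<open>F(n+1,j+1)\<close>, plus a remainder \<open>x F(n,j)\<close>. The remainders add up
  to \<open>x F(n+1,1)\<close>, the one term still missing from the expansion of
  \<open>F(n+2,k+1)\<close>.\<close>

lemma first_entry_poly_Suc_Suc_eq_euler_op:
  assumes "1 \<le> n" "1 \<le> k" "k \<le> n"
  shows "first_entry_poly (n + 1) (k + 1) = monom 1 1 * euler_op n (first_entry_poly n k :: 'a::idom poly)"
  using assms
proof (induction n arbitrary: k rule: nat_induct_at_least)
  case base
  then show ?case
    using first_entry_poly_Suc[of 1 "k + 1", where 'a='a] first_entry_poly_1[where 'a='a]
    by (simp add: euler_op_def del: One_nat_def)
next
  case (Suc n)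
  let ?F = "first_entry_poly :: nat \<Rightarrow> nat \<Rightarrow> 'a poly" and ?X = "monom 1 1 :: 'a poly"
  have k: "k \<le> n + 1" using Suc.prems by simp
  have "?X * euler_op (n + 1) (?F (n + 1) k) =
      (\<Sum>j\<in>{1..n}. ?X * euler_op (n + 1) ((if j < k then ?X else 1) * ?F n j))"
    unfolding first_entry_poly_Suc[OF Suc.hyps Suc.prems(1) k] euler_op_sum sum_distrib_left ..
  also have "\<dots> = (\<Sum>j\<in>{1..n}. (if j < k then ?X else 1) * ?F (n + 1) (j + 1) + ?X * ?F n j)"
  proof (rule sum.cong[OF refl])
    fix j assume "j \<in> {1..n}"
    then have IH: "?F (n + 1) (j + 1) = ?X * euler_op n (?F n j)" by (intro Suc.IH) auto
    show "?X * euler_op (n + 1) ((if j < k then ?X else 1) * ?F n j) =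
        (if j < k then ?X else 1) * ?F (n + 1) (j + 1) + ?X * ?F n j"
    proof (cases "j < k")
      case True
      then show ?thesis unfolding IH by (simp only: if_True euler_op_Suc_mult_X distrib_left)
    next
      case False
      then show ?thesis unfolding IH by (simp only: if_False euler_op_Suc distrib_left mult_1_left)
    qed
  qed
  also have "\<dots> = ?X * (\<Sum>j\<in>{1..n}. ?F n j) + (\<Sum>j\<in>{1..n}. (if j < k then ?X else 1) * ?F (n + 1) (j + 1))"
    by (simp add: sum.distrib sum_distrib_left)
  also have "(\<Sum>j\<in>{1..n}. ?F n j) = ?F (n + 1) 1"
    using Suc first_entry_poly_Suc[of n 1, where 'a='a] by simp
  \<comment> \<open>Shift the index: \<open>j < k\<close> iff \<open>j + 1 < k + 1\<close>, and the
    new term at 1 has weight x because \<open>1 < k + 1\<close>.\<close>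
  also have "?X * ?F (n + 1) 1 + (\<Sum>j\<in>{1..n}. (if j < k then ?X else 1) * ?F (n + 1) (j + 1)) =
      (\<Sum>j\<in>{1..n+1}. (if j < k + 1 then ?X else 1) * ?F (n + 1) j)"
    unfolding sum_shift_Suc using Suc.prems by simp
  also have "\<dots> = ?F (n + 1 + 1) (k + 1)"
    using Suc by (intro first_entry_poly_Suc[symmetric]) auto
  finally show ?case by simp
qed

text \<open>A first entry \<open>n + 1\<close> always creates a descent and a first entry 1 never
  does, so \<open>F(n+1,n+1) = x F(n+1,1)\<close>. Comparing with the previous recurrence at
  \<open>k = n\<close>, cancel x in the integral domain.\<close>

lemma first_entry_poly_Suc_1_eq_euler_op:
  assumes "1 \<le> n"
  shows "first_entry_poly (n + 1) 1 = euler_op n (first_entry_poly n n :: 'a::idom poly)"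
proof -
  let ?F = "first_entry_poly :: nat \<Rightarrow> nat \<Rightarrow> 'a poly" and ?X = "monom 1 1 :: 'a poly"
  have "?X * euler_op n (?F n n) = ?F (n + 1) (n + 1)"
    using first_entry_poly_Suc_Suc_eq_euler_op[of n n, where 'a='a] assms by simp
  also have "\<dots> = (\<Sum>j\<in>{1..n}. ?X * ?F n j)"
    using assms by (subst first_entry_poly_Suc) (auto intro!: sum.cong)
  also have "\<dots> = ?X * ?F (n + 1) 1"
    using assms by (subst first_entry_poly_Suc) (auto simp: sum_distrib_left intro!: sum.cong)
  finally show ?thesis by simp
qed

section \<open>Rolle's theorem and the zeros of \<open>euler_op n F\<close>\<close>

lemma degree_euler_op:
  fixes F :: "'a::{idom,ring_char_0} poly"
  assumes "F \<noteq> 0" and "degree F < n"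
  shows "degree (euler_op n F) = degree F" and "euler_op n F \<noteq> 0"
proof -
  have eq: "coeff (euler_op n F) i = coeff (pderiv F) i - of_nat i * coeff F i + of_nat n * coeff F i" for i
  proof -
    have "coeff ([:1, -1:] * pderiv F) i = coeff (pderiv F) i - of_nat i * coeff F i"
      by (cases i) (simp_all add: coeff_pderiv)
    then show ?thesis by (simp add: euler_op_def of_nat_poly)
  qed
  \<comment> \<open>The derivative has no term in this degree, so the leading coefficient is scaled
    by \<open>n - degree F\<close>, which is positive.\<close>
  have "coeff (euler_op n F) (degree F) = of_nat (n - degree F) * lead_coeff F"
    using assms by (simp add: eq coeff_pderiv coeff_eq_0 algebra_simps)
  then have ne: "coeff (euler_op n F) (degree F) \<noteq> 0" using assms by simp
  then show "euler_op n F \<noteq> 0" by auto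
  have "degree (euler_op n F) \<le> degree F"
    by (rule degree_le) (simp add: eq coeff_pderiv coeff_eq_0)
  then show "degree (euler_op n F) = degree F" using le_degree[OF ne] by simp
qed

text \<open>Decay at \<open>-\<infinity>\<close> replaces the left zero. Working with the square of
  \<open>f\<close> turns positive and negative extrema alike into maxima.\<close>

lemma Rolle_at_bot:
  fixes f f' :: "real \<Rightarrow> real"
  assumes lim: "(f \<longlongrightarrow> 0) at_bot" and fb: "f b = 0"
    and der: "\<And>x. x \<le> b \<Longrightarrow> (f has_real_derivative f' x) (at x)"
  shows "\<exists>z<b. f' z = 0"
proof (cases "f (b - 1) = 0")
  case True
  have "\<exists>z>b - 1. z < b \<and> f b - f (b - 1) = (b - (b - 1)) * f' z"
    by (rule MVT2) (auto intro: der)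
  then show ?thesis using True fb by auto
next
  case False
  then have "\<forall>\<^sub>F x in at_bot. \<bar>f x\<bar> < \<bar>f (b - 1)\<bar>"
    using tendstoD[OF lim, of "\<bar>f (b - 1)\<bar>"] by (simp add: dist_real_def)
  then obtain N where N: "\<And>x. x \<le> N \<Longrightarrow> \<bar>f x\<bar> < \<bar>f (b - 1)\<bar>"
    by (auto simp: eventually_at_bot_linorder)
  \<comment> \<open>Far enough left that \<open>\<bar>f a\<bar> < \<bar>f (b - 1)\<bar>\<close> and
    \<open>b - 1\<close> is interior, so the maximum of the square on \<open>{a..b}\<close> is
    attained at neither endpoint.\<close>
  define a where "a = min N (b - 2)"
  let ?g = "\<lambda>x. (f x)\<^sup>2"
  have dg: "(?g has_real_derivative 2 * f x * f' x) (at x)" if "x \<le> b" for x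
    by (rule derivative_eq_intros der that refl | simp)+
  have "continuous_on {a..b} ?g"
  proof (rule continuous_at_imp_continuous_on, rule ballI)
    show "isCont ?g x" if "x \<in> {a..b}" for x
      by (rule DERIV_isCont[OF dg]) (use that in simp)
  qed
  moreover have "{a..b} \<noteq> {}" by (auto simp: a_def)
  ultimately obtain x where x: "x \<in> {a..b}" and max: "\<And>y. y \<in> {a..b} \<Longrightarrow> ?g y \<le> ?g x"
    using continuous_attains_sup[OF compact_Icc] by metis
  have "?g (b - 1) \<le> ?g x" by (rule max) (auto simp: a_def)
  then have ge: "\<bar>f (b - 1)\<bar> \<le> \<bar>f x\<bar>" by (simp add: abs_le_square_iff)
  have "x \<noteq> a" using ge N[of a] by (auto simp: a_def)
  moreover have "x \<noteq> b" using ge fb False by auto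
  ultimately have xab: "a < x" "x < b" using x by auto
  \<comment> \<open>At the interior maximum \<open>f x\<close> is nonzero, hence
    \<open>f' x = 0\<close>.\<close>
  have "2 * f x * f' x = 0"
  proof (rule DERIV_local_max[OF dg])
    show "0 < min (x - a) (b - x)" using xab by simp
    show "\<forall>y. \<bar>x - y\<bar> < min (x - a) (b - x) \<longrightarrow> ?g y \<le> ?g x" by (auto intro!: max)
  qed (use xab in simp)
  then show ?thesis using ge False xab by auto
qed

lemma euler_op_has_derivative:
  fixes F :: "real poly"
  assumes "x \<le> 0"
  shows "((\<lambda>x. poly F x / (1 - x) ^ n) has_real_derivative
           poly (euler_op n F) x / (1 - x) ^ (n + 1)) (at x)"
proof -
  have ne: "1 - x \<noteq> 0" using assms by simp
  have "((\<lambda>x. poly F x / (1 - x) ^ n) has_real_derivative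
     (poly (pderiv F) x * (1 - x) ^ n - poly F x * (of_nat n * (1 - x) ^ (n - 1) * (- 1))) /
       ((1 - x) ^ n * (1 - x) ^ n)) (at x)"
    by (rule derivative_eq_intros poly_DERIV refl | use ne in simp)+
  also have "(poly (pderiv F) x * (1 - x) ^ n - poly F x * (of_nat n * (1 - x) ^ (n - 1) * (- 1))) /
       ((1 - x) ^ n * (1 - x) ^ n) = poly (euler_op n F) x / (1 - x) ^ (n + 1)"
  proof -
    have "poly (euler_op n F) x = (1 - x) * poly (pderiv F) x + of_nat n * poly F x"
      by (simp add: euler_op_def of_nat_poly algebra_simps)
    \<comment> \<open>Naming \<open>1 - x\<close> keeps it atomic for the simplifier; the cases on
      \<open>n\<close> resolve the truncated exponent \<open>n - 1\<close>.\<close>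
    moreover define y where "y = 1 - x"
    ultimately show ?thesis
      using ne unfolding y_def[symmetric] by (cases n) (simp_all add: field_simps)
  qed
  finally show ?thesis .
qed

lemma tendsto_poly_div_power_at_bot:
  fixes F :: "real poly"
  assumes "degree F < n"
  shows "((\<lambda>x. poly F x / (1 - x) ^ n) \<longlongrightarrow> 0) at_bot"
proof -
  have "degree ([:1, -1::real:] ^ n) = n" by (simp add: degree_power_eq)
  then have "((\<lambda>x. poly F x / poly ([:1, -1:] ^ n) x) \<longlongrightarrow> 0) at_infinity"
    using assms by (intro poly_divide_tendsto_0_at_infinity) simp
  then have "((\<lambda>x. poly F x / poly ([:1, -1:] ^ n) x) \<longlongrightarrow> 0) at_bot"
    by (rule filterlim_mono) (auto simp: at_bot_le_at_infinity)
  then show ?thesis by simp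
qed

text \<open>To each zero \<open>r\<close> of \<open>F\<close> we assign a zero of \<open>euler_op n F\<close> lying between the preceding zero of
  \<open>F\<close> (or \<open>-\<infinity>\<close>) and \<open>r\<close>.\<close>

lemma card_negative_roots_euler_op:
  fixes F :: "real poly"
  assumes F: "F \<noteq> 0" and deg: "degree F < n"
    and roots: "card {x. x \<le> 0 \<and> poly F x = 0} = degree F"
  shows "card {x. x < 0 \<and> poly (euler_op n F) x = 0} = degree F"
proof (rule antisym)
  define R where "R = {x. x \<le> 0 \<and> poly F x = 0}"
  let ?G = "\<lambda>x. poly F x / (1 - x) ^ n"
  let ?G' = "\<lambda>x. poly (euler_op n F) x / (1 - x) ^ (n + 1)"
  have finR: "finite R" unfolding R_def
    by (rule finite_subset[OF _ poly_roots_finite[OF F]]) auto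
  have fin: "finite {x. poly (euler_op n F) x = 0}"
    using poly_roots_finite[OF degree_euler_op(2)[OF F deg]] .
  have "\<exists>s<r. poly (euler_op n F) s = 0 \<and> (\<forall>t\<in>R. t < r \<longrightarrow> t < s)" if r: "r \<in> R" for r
  proof -
    have r0: "r \<le> 0" "?G r = 0" using r by (auto simp: R_def)
    have "\<exists>s<r. ?G' s = 0 \<and> (\<forall>t\<in>R. t < r \<longrightarrow> t < s)"
    proof (cases "{t\<in>R. t < r} = {}")
      \<comment> \<open>For the least zero \<open>r\<close> the left end is
        \<open>-\<infinity>\<close>.\<close>
      case True
      have "\<exists>s<r. ?G' s = 0"
        by (rule Rolle_at_bot[OF tendsto_poly_div_power_at_bot[OF deg] r0(2)])
           (use r0 in \<open>auto intro: euler_op_has_derivative[simplified]\<close>)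
      then show ?thesis using True by blast
    next
      case False
      \<comment> \<open>The zero of \<open>F\<close> directly preceding \<open>r\<close>; ordinary
        Rolle applies between the two.\<close>
      define t where "t = Max {t\<in>R. t < r}"
      have t: "t \<in> R" "t < r" using Max_in[OF _ False] finR by (auto simp: t_def)
      have le: "u \<le> t" if "u \<in> R" "u < r" for u
        using that finR by (auto simp: t_def)
      have "\<exists>s>t. s < r \<and> ?G r - ?G t = (r - t) * ?G' s"
        by (rule MVT2[OF t(2)]) (use r0 in \<open>auto intro: euler_op_has_derivative[simplified]\<close>)
      then obtain s where "t < s" "s < r" "?G r - ?G t = (r - t) * ?G' s" by blast
      moreover have "?G t = 0" using t by (auto simp: R_def)
      ultimately show ?thesis using r0 t le by (intro exI[of _ s]) fastforce
    qed
    then show ?thesis using r0 by fastforce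
  qed
  then obtain s where s: "\<And>r. r \<in> R \<Longrightarrow> s r < r" "\<And>r. r \<in> R \<Longrightarrow> poly (euler_op n F) (s r) = 0"
    "\<And>r t. r \<in> R \<Longrightarrow> t \<in> R \<Longrightarrow> t < r \<Longrightarrow> t < s r" by metis
  \<comment> \<open>For \<open>t < r\<close> in \<open>R\<close> the points interlace:
    \<open>s t < t < s r\<close>.\<close>
  have "inj_on s R"
    by (rule linorder_inj_onI) (use s in fastforce)+
  moreover have "s ` R \<subseteq> {x. x < 0 \<and> poly (euler_op n F) x = 0}"
    using s by (fastforce simp: R_def)
  ultimately have "card R \<le> card {x. x < 0 \<and> poly (euler_op n F) x = 0}"
    using fin by (intro card_inj_on_le) (auto intro: finite_subset)
  then show "degree F \<le> card {x. x < 0 \<and> poly (euler_op n F) x = 0}"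
    using roots by (simp add: R_def)
  have "card {x. x < 0 \<and> poly (euler_op n F) x = 0} \<le> card {x. poly (euler_op n F) x = 0}"
    using fin by (intro card_mono) auto
  also have "\<dots> \<le> degree F"
    using card_poly_roots_bound[OF degree_euler_op(2)[OF F deg]] degree_euler_op(1)[OF F deg] by simp
  finally show "card {x. x < 0 \<and> poly (euler_op n F) x = 0} \<le> degree F" .
qed

definition nonpos_simple_rooted :: "nat \<Rightarrow> real poly \<Rightarrow> bool" where
  "nonpos_simple_rooted n F \<longleftrightarrow>
     F \<noteq> 0 \<and> degree F < n \<and> card {x. x \<le> 0 \<and> poly F x = 0} = degree F"

lemma nonpos_simple_rooted_euler_op:
  assumes "nonpos_simple_rooted n F"
  shows "nonpos_simple_rooted (n + 1) (euler_op n F)"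
    and "nonpos_simple_rooted (n + 1) (monom 1 1 * euler_op n F)"
proof -
  have F: "F \<noteq> 0" "degree F < n" "card {x. x \<le> 0 \<and> poly F x = 0} = degree F"
    using assms by (auto simp: nonpos_simple_rooted_def)
  let ?H = "euler_op n F"
  note deg = degree_euler_op[OF F(1,2)]
  have card: "card {x. x < 0 \<and> poly ?H x = 0} = degree F"
    by (rule card_negative_roots_euler_op[OF F])
  have fin: "finite {x. poly ?H x = 0}" by (rule poly_roots_finite[OF deg(2)])
  have "card {x. x < 0 \<and> poly ?H x = 0} \<le> card {x. x \<le> 0 \<and> poly ?H x = 0}"
    using fin by (intro card_mono) (auto intro: finite_subset)
  moreover have "card {x. x \<le> 0 \<and> poly ?H x = 0} \<le> card {x. poly ?H x = 0}"
    using fin by (intro card_mono) auto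
  moreover have "card {x. poly ?H x = 0} \<le> degree ?H" by (rule card_poly_roots_bound[OF deg(2)])
  ultimately show "nonpos_simple_rooted (n + 1) ?H"
    using F deg card by (simp add: nonpos_simple_rooted_def)
  \<comment> \<open>The \<open>degree F\<close> zeros already found are strictly negative, so the
    factor x adds 0 as a new, distinct zero.\<close>
  have "{x. x \<le> 0 \<and> poly (monom 1 1 * ?H) x = 0} = insert 0 {x. x < 0 \<and> poly ?H x = 0}"
    by (auto simp: poly_monom)
  moreover have "finite {x. x < 0 \<and> poly ?H x = 0}"
    by (rule finite_subset[OF _ fin]) auto
  moreover have "degree (monom 1 1 * ?H) = degree F + 1"
    using deg by (simp add: degree_mult_eq degree_monom_eq)
  ultimately show "nonpos_simple_rooted (n + 1) (monom 1 1 * ?H)"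
    using F deg card by (simp add: nonpos_simple_rooted_def)
qed

lemma nonpos_simple_rooted_first_entry_poly:
  assumes "1 \<le> n" "1 \<le> k" "k \<le> n"
  shows "nonpos_simple_rooted n (first_entry_poly n k)"
  using assms
proof (induction n arbitrary: k rule: nat_induct_at_least)
  case base
  then have "k = 1" by simp
  then show ?case using first_entry_poly_1[where 'a=real]
    by (simp add: nonpos_simple_rooted_def)
next
  case (Suc n)
  show ?case
  proof (cases "k = 1")
    \<comment> \<open>\<open>F(n+1,1)\<close> arises from \<open>F(n,n)\<close>; every other
      \<open>F(n+1,k)\<close> arises from \<open>F(n,k-1)\<close>.\<close>
    case True
    then show ?thesis
      using first_entry_poly_Suc_1_eq_euler_op[OF Suc(1), where 'a=real]
        nonpos_simple_rooted_euler_op(1)[OF Suc.IH[of n]] Suc by simp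
  next
    case False
    define j where "j = k - 1"
    have "k = j + 1" "1 \<le> j" "j \<le> n"
      using False Suc.prems by (auto simp: j_def)
    then show ?thesis
      using first_entry_poly_Suc_Suc_eq_euler_op[OF Suc(1), of j, where 'a=real]
        nonpos_simple_rooted_euler_op(2)[OF Suc.IH[of j]] by simp
  qed
qed

section \<open>Simplicity of zeros and passage to the complex numbers\<close>

lemma order_eq_1_if_card_roots_eq_degree:
  fixes F :: "'a::idom poly"
  assumes F: "F \<noteq> 0" and card: "card {x. poly F x = 0} = degree F" and z: "poly F z = 0"
  shows "order z F = 1"
proof (rule ccontr)
  assume "order z F \<noteq> 1"
  moreover have "order z F \<noteq> 0" using F z order_root by blast
  ultimately have "2 \<le> order z F" by simp
  then have "[:- z, 1:] ^ 2 dvd F" using F order_divides by blast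
  then obtain q where "F = [:- z, 1:] ^ 2 * q" by (rule dvdE)
  then have q: "F = [:- z, 1:] * ([:- z, 1:] * q)" by (simp only: power2_eq_square mult.assoc)
  let ?g = "[:- z, 1:] * q"
  have g: "?g \<noteq> 0" using F q by auto
  \<comment> \<open>Removing one copy of a repeated factor loses no zero but lowers the degree,
    leaving more zeros than the degree allows.\<close>
  have "{x. poly F x = 0} = {x. poly ?g x = 0}" unfolding q by auto
  then have "card {x. poly F x = 0} \<le> degree ?g" using card_poly_roots_bound[OF g] by simp
  moreover have "degree F = 1 + degree ?g"
    unfolding q using g by (subst degree_mult_eq) auto
  ultimately show False using card by simp
qed

theorem theorem5:
  fixes n k :: nat and F :: "complex poly"
  assumes "n \<ge> 1" and "1 \<le> k" and "k \<le> n"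
  defines "F \<equiv> descent_poly n (linear_extensions n (poset_P n k))"
  shows "(\<forall>z. poly F z = 0 \<longrightarrow> z \<in> \<real>) \<and> (\<forall>z. poly F z = 0 \<longrightarrow> order z F = 1)"
proof -
  define p :: "real poly" where "p = first_entry_poly n k"
  have F: "F = first_entry_poly n k"
    using assms by (simp add: F_def linear_extensions_poset_P first_entry_perms_def)
  have coeff: "coeff F i = of_real (coeff p i)" for i
    by (auto simp: F p_def descent_poly_def coeff_sum intro!: sum.cong)
  have poly: "poly F (of_real x) = of_real (poly p x)" for x
    by (simp add: F p_def descent_poly_def poly_sum poly_monom)
  have "nonpos_simple_rooted n p"
    unfolding p_def by (rule nonpos_simple_rooted_first_entry_poly[OF assms(1-3)])
  then have p: "p \<noteq> 0" "card {x. x \<le> 0 \<and> poly p x = 0} = degree p"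
    by (auto simp: nonpos_simple_rooted_def)
  have deg: "degree F = degree p" by (simp add: degree_def coeff)
  have F0: "F \<noteq> 0" using p(1) coeff by (metis coeff_0 leading_coeff_0_iff of_real_eq_0_iff)
  let ?R = "complex_of_real ` {x. x \<le> 0 \<and> poly p x = 0}"
  have sub: "?R \<subseteq> {z. poly F z = 0}" by (auto simp: poly)
  have cardR: "card ?R = degree F"
    using p(2) deg by (simp add: card_image inj_on_def)
  have fin: "finite {z. poly F z = 0}" by (rule poly_roots_finite[OF F0])
  \<comment> \<open>The real zeros of \<open>p\<close> already number \<open>degree F\<close>, so no
    room remains for further complex zeros.\<close>
  have roots: "{z. poly F z = 0} = ?R"
    using card_seteq[OF fin sub] card_poly_roots_bound[OF F0] cardR by simp
  then have "card {z. poly F z = 0} = degree F" using cardR by simp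
  moreover have "z \<in> \<real>" if "poly F z = 0" for z
    using that roots by (auto simp: set_eq_iff image_iff)
  ultimately show ?thesis
    using order_eq_1_if_card_roots_eq_degree[OF F0] by blast
qed

end
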